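(* For $d\ge1$ let $X[n,d]=|\{i\in L_n(1):\ \deg_n(i)=d\}|$ be the number of vertices of degree $d$ in the first level of $T_n$. Then $X[n,1],X[n,2],\dots$ are asymptotically i.i.d. Poisson with mean $1$: for every $d\ge1$, the random vector $(X[n,1],\dots,X[n,d])$ converges in distribution, as $n\to\infty$, to a vector of $d$ independent Poisson random variables each with mean $1$.
   Context: Uniform random recursive tree: start at step $0$ with the tree $T_0$ consisting of the single vertex $0$ (the root). At step $n\ge1$, a vertex is chosen uniformly at random among the existing vertices $0,1,\dots,n-1$, independently of the past, and a new vertex $n$ is added and joined by an edge to the chosen vertex; $T_n$ is the resulting tree on vertices $0,\dots,n$. $\deg_n(i)$ is the degree of vertex $i$ in $T_n$, and $L_n(1)$ is the set of vertices of $T_n$ at graph distance $1$ from the root (the neighbours of $0$). *)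

theory Defs
  imports "HOL-Probability.Probability"
begin

text \<open>A realisation of the uniform random recursive tree up to step n is encoded by
  its parent function: vertex k (1 \<le> k \<le> n) is attached to the vertex par k < k.
  Outside {1..n} the function is fixed to 0 (canonical representative).\<close>

definition rrt_parents :: "nat \<Rightarrow> (nat \<Rightarrow> nat) set" where
  "rrt_parents n = {par. (\<forall>k\<in>{1..n}. par k < k) \<and> (\<forall>k. k \<notin> {1..n} \<longrightarrow> par k = 0)}"

text \<open>Independent uniform choices at each step = uniform law on the product set.\<close>
definition rrt_pmf :: "nat \<Rightarrow> (nat \<Rightarrow> nat) pmf" where
  "rrt_pmf n = pmf_of_set (rrt_parents n)"

definition rrt_edges :: "nat \<Rightarrow> (nat \<Rightarrow> nat) \<Rightarrow> nat set set" where
  "rrt_edges n par = {{k, par k} | k. k \<in> {1..n}}"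

definition rrt_deg :: "nat \<Rightarrow> (nat \<Rightarrow> nat) \<Rightarrow> nat \<Rightarrow> nat" where
  "rrt_deg n par i = card {e \<in> rrt_edges n par. i \<in> e}"

definition rrt_level1 :: "nat \<Rightarrow> (nat \<Rightarrow> nat) \<Rightarrow> nat set" where
  "rrt_level1 n par = {i \<in> {0..n}. i \<noteq> 0 \<and> {0, i} \<in> rrt_edges n par}"

definition rrt_X :: "nat \<Rightarrow> nat \<Rightarrow> (nat \<Rightarrow> nat) \<Rightarrow> nat" where
  "rrt_X n d par = card {i \<in> rrt_level1 n par. rrt_deg n par i = d}"

text \<open>Convergence in distribution of random elements of a discrete countable space
  (here N^d, encoded as functions nat \<Rightarrow> nat that are 0 outside {1..d}): every bounded
  function is continuous for the discrete topology, so the definition reads: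
  expectations of all bounded test functions converge.\<close>
definition converges_in_distribution :: "(nat \<Rightarrow> 'a pmf) \<Rightarrow> 'a pmf \<Rightarrow> bool" where
  "converges_in_distribution P Q \<longleftrightarrow>
     (\<forall>f :: 'a \<Rightarrow> real. bounded (range f) \<longrightarrow>
        (\<lambda>n. measure_pmf.expectation (P n) f) \<longlonglongrightarrow> measure_pmf.expectation Q f)"

end

theory Submission
  imports Defs
begin

text \<open>
  Write \<open>X\<^sub>j\<close> for the number of level-one vertices of degree \<open>j\<close>. The vector of the \<open>X\<^sub>j\<close> is a
  Markov chain of its own: when vertex \<open>n + 1\<close> arrives, with probability \<open>1 / (n + 1)\<close> it becomes a new
  level-one vertex of degree \<open>1\<close>, with probability \<open>X\<^sub>j / (n + 1)\<close> some level-one vertex moves from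
  degree \<open>j\<close> to \<open>j + 1\<close>, and otherwise nothing changes. Mixed falling factorials are mapped
  by the generator of this chain to combinations of mixed falling factorials: with \<open>a\<^sub>r(n)\<close> the mixed
  factorial moment of order \<open>r = (r\<^sub>1, \<dots>, r\<^sub>d)\<close>,
  \<open>(n + 1) a\<^sub>r(n + 1) = (n + 1 - (r\<^sub>1 + \<dots> + r\<^sub>d)) a\<^sub>r(n) + (r\<^sub>1 a(n) + \<dots> + r\<^sub>d a(n))\<close>,
  where the order in the \<open>j\<close>-th summand of the last bracket has one unit moved from coordinate \<open>j\<close> to \<open>j - 1\<close> (dropped if \<open>j = 1\<close>).
  By induction, \<open>0 \<le> a\<^sub>r(n) \<le> 1\<close> and \<open>a\<^sub>r(n)\<close> tends to \<open>1\<close>, the corresponding moment of independent Poisson variables.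
  Binomial inversion writes \<open>P(X = k)\<close> as an absolutely convergent series in the \<open>a\<^sub>r(n)\<close>, so the
  point probabilities converge by dominated convergence, and Scheffe's lemma gives convergence of
  the expectations of all bounded functions.
\<close>

section \<open>Probability mass functions and limits\<close>

text \<open>Independence of the coordinates. Only integrability of the factors is assumed, since the
  inversion kernels below change sign.\<close>

lemma expectation_prod_Pi_pmf_real:
  fixes f :: "'a \<Rightarrow> 'b \<Rightarrow> real"
  assumes "finite A" "\<And>x. x \<in> A \<Longrightarrow> integrable (measure_pmf (p x)) (f x)"
  shows "measure_pmf.expectation (Pi_pmf A dflt p) (\<lambda>y. \<Prod>x\<in>A. f x (y x)) =
           (\<Prod>x\<in>A. measure_pmf.expectation (p x) (f x))"
proof -
  let ?Q = "Pi_pmf A dflt p"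
  have comp: "map_pmf (\<lambda>y. y x) ?Q = p x" if "x \<in> A" for x
    using assms(1) that by (simp add: Pi_pmf_component)
  have "prob_space.indep_vars ?Q (\<lambda>_. borel) (\<lambda>x y. f x (y x)) A"
    by (rule prob_space.indep_vars_compose2[OF measure_pmf.prob_space_axioms indep_vars_Pi_pmf[OF assms(1)]]) simp
  moreover have "integrable ?Q (\<lambda>y. f x (y x))" if "x \<in> A" for x
    using assms(2)[OF that] unfolding comp[OF that, symmetric] by simp
  ultimately have "measure_pmf.expectation ?Q (\<lambda>y. \<Prod>x\<in>A. f x (y x)) =
      (\<Prod>x\<in>A. measure_pmf.expectation ?Q (\<lambda>y. f x (y x)))"
    by (intro prob_space.indep_vars_lebesgue_integral[OF measure_pmf.prob_space_axioms] assms(1))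
  also have "\<dots> = (\<Prod>x\<in>A. measure_pmf.expectation (p x) (f x))"
  proof (rule prod.cong)
    fix x assume "x \<in> A"
    then show "measure_pmf.expectation ?Q (\<lambda>y. f x (y x)) = measure_pmf.expectation (p x) (f x)"
      using integral_map_pmf[of "\<lambda>y. y x" ?Q "f x"] comp by simp
  qed simp
  finally show ?thesis .
qed

text \<open>By Scheffe, pointwise convergence of probability densities is \<open>L1\<close>
  convergence, and a test function bounded by \<open>B\<close> costs at most the factor
  \<open>B\<close>.\<close>

lemma converges_in_distribution_pmfI:
  fixes P :: "nat \<Rightarrow> 'a pmf"
  assumes "\<And>x. (\<lambda>n. pmf (P n) x) \<longlonglongrightarrow> pmf Q x"
  shows "converges_in_distribution P Q"
  unfolding converges_in_distribution_def
proof (intro allI impI)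
  fix f :: "'a \<Rightarrow> real" assume "bounded (range f)"
  then obtain B where B: "\<And>x. \<bar>f x\<bar> \<le> B"
    by (auto simp: bounded_iff)
  let ?C = "count_space (UNIV :: 'a set)"
  have one: "(\<integral>\<^sup>+x. norm (pmf p x) \<partial>?C) = 1" for p :: "'a pmf"
    by (simp add: nn_integral_pmf measure_pmf.emeasure_space_1[simplified])
  have "(\<lambda>n. \<integral>\<^sup>+x. norm (pmf (P n) x - pmf Q x) \<partial>?C) \<longlonglongrightarrow> 0"
    by (rule Scheffe_lemma2) (use assms one in \<open>auto simp: integrable_pmf\<close>)
  moreover have int: "integrable ?C (\<lambda>x. pmf (P n) x - pmf Q x)" for n
    by (intro Bochner_Integration.integrable_diff integrable_pmf)
  ultimately have "(\<lambda>n. ennreal (\<integral>x. \<bar>pmf (P n) x - pmf Q x\<bar> \<partial>?C)) \<longlonglongrightarrow> ennreal 0"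
    by (simp add: nn_integral_eq_integral)
  then have "(\<lambda>n. \<integral>x. \<bar>pmf (P n) x - pmf Q x\<bar> \<partial>?C) \<longlonglongrightarrow> 0"
    by (subst (asm) tendsto_ennreal_iff) auto
  then have lim: "(\<lambda>n. B * (\<integral>x. \<bar>pmf (P n) x - pmf Q x\<bar> \<partial>?C)) \<longlonglongrightarrow> 0"
    by (rule tendsto_mult_right_zero)
  have intf: "integrable ?C (\<lambda>x. pmf p x * f x)" for p :: "'a pmf"
    by (rule Bochner_Integration.integrable_bound[OF integrable_mult_left[OF integrable_pmf[of UNIV p], of B]])
       (use B in \<open>auto simp: abs_mult intro!: mult_left_mono order_trans[OF B] abs_ge_self\<close>)
  have ex: "measure_pmf.expectation p f = (\<integral>x. pmf p x * f x \<partial>?C)" for p :: "'a pmf"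
    unfolding measure_pmf_eq_density by (subst integral_density) auto
  have "norm (measure_pmf.expectation (P n) f - measure_pmf.expectation Q f) \<le>
      B * (\<integral>x. \<bar>pmf (P n) x - pmf Q x\<bar> \<partial>?C)" for n
  proof -
    have "measure_pmf.expectation (P n) f - measure_pmf.expectation Q f =
        (\<integral>x. (pmf (P n) x - pmf Q x) * f x \<partial>?C)"
      unfolding ex by (subst Bochner_Integration.integral_diff[symmetric])
        (auto simp: intf left_diff_distrib)
    also have "norm \<dots> \<le> (\<integral>x. norm ((pmf (P n) x - pmf Q x) * f x) \<partial>?C)"
      by (rule integral_norm_bound)
    also have "\<dots> \<le> (\<integral>x. B * \<bar>pmf (P n) x - pmf Q x\<bar> \<partial>?C)"
    proof (rule integral_mono)
      have "integrable ?C (\<lambda>x. (pmf (P n) x - pmf Q x) * f x)"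
        using Bochner_Integration.integrable_diff[OF intf[of "P n"] intf[of Q]]
        by (simp add: algebra_simps)
      then show "integrable ?C (\<lambda>x. norm ((pmf (P n) x - pmf Q x) * f x))"
        by (rule integrable_norm)
      show "integrable ?C (\<lambda>x. B * \<bar>pmf (P n) x - pmf Q x\<bar>)"
        using int[of n] by simp
      show "norm ((pmf (P n) x - pmf Q x) * f x) \<le> B * \<bar>pmf (P n) x - pmf Q x\<bar>" for x
        using mult_left_mono[OF B[of x], of "\<bar>pmf (P n) x - pmf Q x\<bar>"]
        by (simp add: abs_mult mult_ac)
    qed
    finally show ?thesis by simp
  qed
  then have "(\<lambda>n. measure_pmf.expectation (P n) f - measure_pmf.expectation Q f) \<longlonglongrightarrow> 0"
    by (intro Lim_null_comparison[OF always_eventually lim]) auto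
  then show "(\<lambda>n. measure_pmf.expectation (P n) f) \<longlonglongrightarrow> measure_pmf.expectation Q f"
    by (simp add: LIM_zero_iff)
qed

text \<open>Once n is at least c, \<open>n * \<bar>u n\<bar>\<close> grows by at most
  \<open>\<bar>v n\<bar>\<close> per step, because \<open>c \<ge> 1\<close> gives
  \<open>n + 1 - c \<le> n\<close>. Hence \<open>\<bar>u n\<bar>\<close> is dominated by a Cesaro
  mean of a null sequence plus a term of order 1/n.\<close>

lemma tendsto_0_averaging_recurrence:
  fixes u v :: "nat \<Rightarrow> real"
  assumes v: "v \<longlonglongrightarrow> 0" and c: "c \<ge> 1"
    and rec: "\<And>n. u (Suc n) = (1 - c / real (Suc n)) * u n + v n / real (Suc n)"
  shows "u \<longlonglongrightarrow> 0"
proof (rule LIMSEQ_I)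
  fix e :: real assume e: "e > 0"
  obtain N0 where N0: "\<And>n. n \<ge> N0 \<Longrightarrow> \<bar>v n\<bar> < e / 2"
    using LIMSEQ_D[OF v, of "e / 2"] e by auto
  define N where "N = max N0 (nat \<lceil>c\<rceil>)"
  define K where "K = real N * \<bar>u N\<bar>"
  have scaled_step: "real (Suc n) * \<bar>u (Suc n)\<bar> \<le> real n * \<bar>u n\<bar> + e / 2" if n: "n \<ge> N" for n
  proof -
    have cn: "c \<le> real n" using n unfolding N_def by linarith
    have "real (Suc n) * u (Suc n) = (real (Suc n) - c) * u n + v n"
      unfolding rec by (simp add: distrib_left left_diff_distrib right_diff_distrib del: of_nat_Suc)
    then have "real (Suc n) * \<bar>u (Suc n)\<bar> = \<bar>(real (Suc n) - c) * u n + v n\<bar>"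
      by (metis abs_mult abs_of_nat)
    also have "\<dots> \<le> (real (Suc n) - c) * \<bar>u n\<bar> + \<bar>v n\<bar>"
      using cn by (intro order_trans[OF abs_triangle_ineq]) (simp add: abs_mult)
    also have "\<dots> \<le> real n * \<bar>u n\<bar> + e / 2"
      using c N0[of n] n by (intro add_mono mult_right_mono) (auto simp: N_def)
    finally show ?thesis .
  qed
  have bound: "real n * \<bar>u n\<bar> \<le> K + real (n - N) * (e / 2)" if "n \<ge> N" for n
    using that
  proof (induction n rule: dec_induct)
    case (step n)
    then have "real (Suc n - N) * (e / 2) = real (n - N) * (e / 2) + e / 2"
      by (simp add: Suc_diff_le distrib_right)
    then show ?case using scaled_step[OF step(1)] step.IH by linarith
  qed (simp add: K_def)
  show "\<exists>no. \<forall>n\<ge>no. norm (u n - 0) < e"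
  \<comment> \<open>Beyond \<open>2 * K / e\<close> the initial term \<open>K\<close> is below
    \<open>n * (e / 2)\<close>; the accumulated increments use the other half of
    \<open>n * e\<close>.\<close>
  proof (intro exI[of _ "max (Suc N) (Suc (nat \<lceil>2 * K / e\<rceil>))"] allI impI)
    fix n assume n: "n \<ge> max (Suc N) (Suc (nat \<lceil>2 * K / e\<rceil>))"
    then have "2 * K / e < real n" by linarith
    then have "K < real n * (e / 2)" using e by (simp add: field_simps)
    moreover have "real (n - N) * (e / 2) \<le> real n * (e / 2)"
      using e by (intro mult_right_mono) auto
    moreover have "real n * \<bar>u n\<bar> \<le> K + real (n - N) * (e / 2)"
      using n by (intro bound) simp
    moreover have "real n * (e / 2) + real n * (e / 2) = real n * e"
      by simp
    ultimately have "real n * \<bar>u n\<bar> < real n * e"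
      by linarith
    then show "norm (u n - 0) < e" using n by simp
  qed
qed

lemma integrable_finite_support_pmf:
  fixes f :: "'a \<Rightarrow> real"
  assumes "finite S" "\<And>x. x \<notin> S \<Longrightarrow> f x = 0"
  shows "integrable (measure_pmf p) f"
proof (rule measure_pmf.integrable_const_bound[where B = "\<Sum>s\<in>S. \<bar>f s\<bar>"])
  have "\<bar>f x\<bar> \<le> (\<Sum>s\<in>S. \<bar>f s\<bar>)" for x
    using assms by (cases "x \<in> S") (auto intro: member_le_sum sum_nonneg)
  then show "AE x in measure_pmf p. norm (f x) \<le> (\<Sum>s\<in>S. \<bar>f s\<bar>)" by simp
qed simp

section \<open>Falling factorials and Poisson inversion\<close>

definition ffall :: "nat \<Rightarrow> nat \<Rightarrow> real" where
  "ffall x r = fact r * real (x choose r)"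

lemma ffall_0_right [simp]: "ffall x 0 = 1"
  by (simp add: ffall_def)

lemma ffall_nonneg [simp]: "ffall x r \<ge> 0"
  by (simp add: ffall_def)

lemma ffall_eq_0: "x < r \<Longrightarrow> ffall x r = 0"
  by (simp add: ffall_def binomial_eq_0)

lemma ffall_Suc_left: "ffall (Suc x) r = ffall x r + real r * ffall x (r - 1)"
  by (cases r) (simp_all add: ffall_def algebra_simps)

lemma ffall_Suc_right: "ffall x (Suc r) = (real x - real r) * ffall x r"
proof (cases "r \<le> x")
  case True
  have "real (Suc r) * real (x choose Suc r) = (real x - real r) * real (x choose r)"
    using binomial_absorb_comp[of x r] binomial_absorption[of r x] True
    by (metis of_nat_diff of_nat_mult)
  then have "fact r * (real (Suc r) * real (x choose Suc r)) = fact r * ((real x - real r) * real (x choose r))"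
    by (rule arg_cong)
  then show ?thesis by (simp add: ffall_def mult_ac del: of_nat_Suc)
qed (simp add: ffall_eq_0)

text \<open>Absorption identity, describing a unit that leaves a slot at rate \<open>x\<close>. For
  \<open>x < r\<close> both sides vanish, so the negative factor on the right is harmless.\<close>

lemma mult_ffall_diff: "real x * ffall (x - 1) r = (real x - real r) * ffall x r"
proof (cases "r \<le> x")
  case True
  have "(real x - real r) * real (x choose r) = real x * real ((x - 1) choose r)"
    using binomial_absorb_comp[of x r] True by (metis of_nat_diff of_nat_mult)
  then show ?thesis by (simp add: ffall_def algebra_simps)
next
  case False
  then show ?thesis by (cases x) (simp_all add: ffall_eq_0)
qed

text \<open>Trinomial revision pulls \<open>x choose k\<close> out of the sum and leaves the
  alternating sum of row \<open>x - k\<close> of Pascal's triangle, which is zero unless that row is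
  row 0.\<close>

lemma alternating_binomial_inversion:
  fixes x k :: nat
  shows "(\<Sum>r\<le>x. (-1) ^ (r + k) * real (r choose k) * real (x choose r)) = of_bool (x = k)"
proof (cases "k \<le> x")
  case True
  have "(\<Sum>r\<le>x. (-1) ^ (r + k) * real (r choose k) * real (x choose r)) =
      (\<Sum>r\<in>{k..x}. (-1) ^ (r + k) * real (r choose k) * real (x choose r))"
    by (rule sum.mono_neutral_right) (auto simp: binomial_eq_0)
  also have "\<dots> = (\<Sum>m\<le>x - k. real (x choose k) * ((-1) ^ m * real ((x - k) choose m)))"
  proof (rule sum.reindex_bij_witness[of _ "\<lambda>m. m + k" "\<lambda>r. r - k"])
    fix r assume r: "r \<in> {k..x}"
    have "real (x choose r) * real (r choose k) = real (x choose k) * real ((x - k) choose (r - k))"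
      using choose_mult[of k r x] r by (metis atLeastAtMost_iff of_nat_mult)
    moreover have "(-1::real) ^ (r - k) = (-1) ^ (r + k)"
      using r by (auto simp: minus_one_power_iff)
    ultimately show "real (x choose k) * ((-1) ^ (r - k) * real ((x - k) choose (r - k))) =
        (-1) ^ (r + k) * real (r choose k) * real (x choose r)"
      by (simp add: algebra_simps)
  qed (use True in auto)
  also have "\<dots> = of_bool (x = k)"
    unfolding sum_distrib_left[symmetric]
    using choose_alternating_sum[of "x - k", where ?'a = real] True by (cases "x = k") auto
  finally show ?thesis .
next
  case False
  then show ?thesis by (auto simp: binomial_eq_0 intro!: sum.neutral)
qed

text \<open>The Poisson weight cancels \<open>exp 1\<close> and the factorial in
  \<open>ffall x r\<close>; the series stops at \<open>r = x\<close> and is the finite inversion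
  sum.\<close>

lemma expectation_poisson_indicator_kernel:
  "measure_pmf.expectation (poisson_pmf 1)
     (\<lambda>r. exp 1 * (-1) ^ (r + k) * real (r choose k) * ffall x r) = of_bool (x = k)"
proof -
  have "measure_pmf.expectation (poisson_pmf 1)
     (\<lambda>r. exp 1 * (-1) ^ (r + k) * real (r choose k) * ffall x r) =
     (\<Sum>r\<le>x. exp 1 * (-1) ^ (r + k) * real (r choose k) * ffall x r * pmf (poisson_pmf 1) r)"
    by (rule integral_measure_pmf_real) (auto simp: ffall_eq_0 intro: leI)
  also have "\<dots> = (\<Sum>r\<le>x. (-1) ^ (r + k) * real (r choose k) * real (x choose r))"
    by (rule sum.cong) (auto simp: ffall_def exp_minus)
  finally show ?thesis by (simp add: alternating_binomial_inversion)
qed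

lemma binomial_div_fact_shift:
  "real ((m + k) choose k) / fact (m + k) = 1 / (fact k * fact m)"
  by (simp add: binomial_fact field_simps)

lemma integrable_poisson_binomial:
  "integrable (poisson_pmf 1) (\<lambda>r. real (r choose k))"
  "integrable (poisson_pmf 1) (\<lambda>r. exp 1 * (-1) ^ (r + k) * real (r choose k))"
proof -
  have "summable (\<lambda>m. inverse (fact m) * (1::real) ^ m)"
    by (rule summable_exp)
  then have "summable (\<lambda>m. real ((m + k) choose k) / fact (m + k))"
    unfolding binomial_div_fact_shift
    by (auto dest: summable_mult[of _ "1 / fact k"] simp: field_simps)
  then have "summable (\<lambda>r. real (r choose k) / fact r)"
    by (subst (asm) summable_iff_shift)
  then have *: "summable (\<lambda>r. exp (-1) * (real (r choose k) / fact r))"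
    by (rule summable_mult)
  show 1: "integrable (poisson_pmf 1) (\<lambda>r. real (r choose k))"
    unfolding measure_pmf_eq_density
    by (subst integrable_density) (use * in \<open>auto simp: integrable_count_space_nat_iff mult_ac\<close>)
  show "integrable (poisson_pmf 1) (\<lambda>r. exp 1 * (-1) ^ (r + k) * real (r choose k))"
    by (rule Bochner_Integration.integrable_bound[OF integrable_mult_right[OF 1, of "exp 1"]])
       (auto simp: abs_mult)
qed

text \<open>This is the inversion series with every factorial moment replaced by 1, its limiting
  value. Substituting \<open>r = m + k\<close> turns it into the exponential series at -1, divided
  by \<open>fact k\<close>.\<close>

lemma expectation_poisson_alternating_binomial:
  "measure_pmf.expectation (poisson_pmf 1) (\<lambda>r. exp 1 * (-1) ^ (r + k) * real (r choose k)) =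
     pmf (poisson_pmf 1) k"
proof -
  let ?f = "\<lambda>r. exp 1 * (-1) ^ (r + k) * real (r choose k)"
  let ?g = "\<lambda>r. pmf (poisson_pmf 1) r * ?f r"
  have int: "integrable (count_space UNIV) ?g"
    using integrable_poisson_binomial(2)[of k] unfolding measure_pmf_eq_density
    by (subst (asm) integrable_density) auto
  have "(\<lambda>m. inverse (fact m) * (-1::real) ^ m) sums exp (-1)"
    using exp_converges[of "-1::real"] by (simp add: scaleR_conv_of_real)
  then have "(\<lambda>m. (1 / fact k) * (inverse (fact m) * (-1::real) ^ m)) sums ((1 / fact k) * exp (-1))"
    by (rule sums_mult)
  moreover have "?g (m + k) = (1 / fact k) * (inverse (fact m) * (-1::real) ^ m)" for m
  proof -
    have "?g (m + k) = (-1) ^ m * (real ((m + k) choose k) / fact (m + k))"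
      by (simp add: exp_minus power_add minus_one_power_iff)
    then show ?thesis unfolding binomial_div_fact_shift by (simp add: field_simps)
  qed
  ultimately have "(\<lambda>m. ?g (m + k)) sums ((1 / fact k) * exp (-1))"
    by simp
  then have "?g sums ((1 / fact k) * exp (-1))"
    by (subst (asm) sums_iff_shift) (simp add: binomial_eq_0)
  then have "suminf ?g = pmf (poisson_pmf 1) k"
    by (simp add: sums_iff)
  moreover have "measure_pmf.expectation (poisson_pmf 1) ?f = integral\<^sup>L (count_space UNIV) ?g"
    unfolding measure_pmf_eq_density by (subst integral_density) auto
  ultimately show ?thesis
    using integral_count_space_nat[OF int] by simp
qed

section \<open>One attachment step of the random recursive tree\<close>

lemma finite_rrt_parents [simp]: "finite (rrt_parents n)"
proof -
  have "rrt_parents n \<subseteq> {f. \<forall>k. (k \<in> {1..n} \<longrightarrow> f k \<in> {..n}) \<and> (k \<notin> {1..n} \<longrightarrow> f k = 0)}"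
    by (force simp: rrt_parents_def dest: bspec)
  then show ?thesis
    by (rule finite_subset) (rule finite_set_of_finite_funs, auto)
qed

lemma rrt_parents_nonempty [simp]: "rrt_parents n \<noteq> {}"
  by (auto simp: rrt_parents_def intro!: exI[of _ "\<lambda>_. 0"])

lemma bij_betw_rrt_parents_Suc:
  "bij_betw (\<lambda>(par, p). par(Suc n := p)) (rrt_parents n \<times> {..n}) (rrt_parents (Suc n))"
proof (rule bij_betwI[where g = "\<lambda>par. (par(Suc n := 0), par (Suc n))"])
  show "(\<lambda>(par, p). par(Suc n := p)) \<in> rrt_parents n \<times> {..n} \<rightarrow> rrt_parents (Suc n)"
    by (auto simp: rrt_parents_def less_Suc_eq_le)
  show "(\<lambda>par. (par(Suc n := 0), par (Suc n))) \<in> rrt_parents (Suc n) \<rightarrow> rrt_parents n \<times> {..n}"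
  proof (intro Pi_I SigmaI)
    fix par assume par: "par \<in> rrt_parents (Suc n)"
    then have "par (Suc n) < Suc n"
      unfolding rrt_parents_def by (auto dest: bspec[of _ _ "Suc n"])
    then show "par (Suc n) \<in> {..n}" by simp
    show "par(Suc n := 0) \<in> rrt_parents n"
      using par by (auto simp: rrt_parents_def)
  qed
qed (auto simp: rrt_parents_def fun_eq_iff)

lemma card_rrt_parents_Suc: "card (rrt_parents (Suc n)) = card (rrt_parents n) * Suc n"
  using bij_betw_same_card[OF bij_betw_rrt_parents_Suc[of n]] by (simp add: card_cartesian_product)

text \<open>Conditioning on the first n steps: by the bijection, the parent of the new vertex is
  uniform on \<open>{..n}\<close> given the earlier tree.\<close>

lemma expectation_rrt_Suc:
  fixes f :: "(nat \<Rightarrow> nat) \<Rightarrow> real"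
  shows "measure_pmf.expectation (rrt_pmf (Suc n)) f =
    measure_pmf.expectation (rrt_pmf n) (\<lambda>par. (\<Sum>p\<le>n. f (par(Suc n := p))) / real (Suc n))"
proof -
  have "sum f (rrt_parents (Suc n)) = (\<Sum>par\<in>rrt_parents n. \<Sum>p\<le>n. f (par(Suc n := p)))"
    using sum.reindex_bij_betw[OF bij_betw_rrt_parents_Suc[of n], of f]
    by (simp add: sum.cartesian_product case_prod_unfold)
  then show ?thesis
    by (simp add: rrt_pmf_def integral_pmf_of_set card_rrt_parents_Suc sum_divide_distrib[symmetric]
          mult_ac del: of_nat_Suc mult_Suc_right mult_Suc)
qed

section \<open>Degrees and level-one counts in terms of the parent function\<close>

lemma rrt_level1_eq: "rrt_level1 n par = {i \<in> {1..n}. par i = 0}"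
  by (auto simp: rrt_level1_def rrt_edges_def doubleton_eq_iff)

lemma rrt_deg_eq:
  assumes "par \<in> rrt_parents n" "i \<in> {1..n}"
  shows "rrt_deg n par i = Suc (card {k \<in> {1..n}. par k = i})"
proof -
  have lt: "par k < k" if "k \<in> {1..n}" for k
    using assms(1) that by (auto simp: rrt_parents_def)
  \<comment> \<open>Each edge is indexed by its larger endpoint \<open>k\<close>, which is
    unambiguous as \<open>par k < k\<close>. The index \<open>i\<close> stands for the edge from
    \<open>i\<close> to its own parent, the others for edges to its children.\<close>
  let ?K = "insert i {k \<in> {1..n}. par k = i}"
  have "inj_on (\<lambda>k. {k, par k}) {1..n}"
    by (rule inj_onI) (metis doubleton_eq_iff lt not_less_iff_gr_or_eq)
  then have "inj_on (\<lambda>k. {k, par k}) ?K"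
    by (rule inj_on_subset) (use assms(2) in auto)
  moreover have "{e \<in> rrt_edges n par. i \<in> e} = (\<lambda>k. {k, par k}) ` ?K"
    using assms(2) by (auto simp: rrt_edges_def)
  ultimately have "rrt_deg n par i = card ?K"
    unfolding rrt_deg_def by (simp only: card_image)
  moreover have "i \<notin> {k \<in> {1..n}. par k = i}"
    using lt by fastforce
  ultimately show ?thesis by simp
qed

lemma rrt_deg_Suc:
  assumes par: "par \<in> rrt_parents n" and p: "p \<le> n" and i: "i \<in> {1..Suc n}"
  shows "rrt_deg (Suc n) (par(Suc n := p)) i =
    (if i = Suc n then 1 else if i = p then Suc (rrt_deg n par i) else rrt_deg n par i)"
proof -
  let ?par = "par(Suc n := p)"
  have par': "?par \<in> rrt_parents (Suc n)"
    using bij_betwE[OF bij_betw_rrt_parents_Suc[of n]] par p by auto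
  have lt: "?par k < k" if "k \<in> {1..Suc n}" for k
    using par' that by (auto simp: rrt_parents_def)
  consider "i = Suc n" | "i \<in> {1..n}" "i = p" | "i \<in> {1..n}" "i \<noteq> p"
    using i by fastforce
  then show ?thesis
  proof cases
    case 1
    then have "{k \<in> {1..Suc n}. ?par k = i} = {}"
      using lt by fastforce
    then show ?thesis using rrt_deg_eq[OF par' i] 1 by (metis One_nat_def card.empty)
  next
    case 2
    then have "{k \<in> {1..Suc n}. ?par k = i} = insert (Suc n) {k \<in> {1..n}. par k = i}"
      by (auto simp: le_Suc_eq)
    then have "card {k \<in> {1..Suc n}. ?par k = i} = Suc (card {k \<in> {1..n}. par k = i})"
      by simp
    then show ?thesis using rrt_deg_eq[OF par' i] rrt_deg_eq[OF par, of i] 2 by auto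
  next
    case 3
    then have "{k \<in> {1..Suc n}. ?par k = i} = {k \<in> {1..n}. par k = i}"
      by (auto simp: le_Suc_eq)
    then show ?thesis using rrt_deg_eq[OF par' i] rrt_deg_eq[OF par, of i] 3 by auto
  qed
qed

lemma rrt_deg_attach:
  assumes "par \<in> rrt_parents n" "p \<le> n"
  shows "rrt_deg (Suc n) (par(Suc n := p)) (Suc n) = 1"
    and "i \<in> rrt_level1 n par \<Longrightarrow>
      rrt_deg (Suc n) (par(Suc n := p)) i = (if i = p then Suc (rrt_deg n par i) else rrt_deg n par i)"
  using assms by (auto simp: rrt_deg_Suc rrt_level1_eq)

lemma rrt_level1_attach:
  "rrt_level1 (Suc n) (par(Suc n := p)) =
    (if p = 0 then insert (Suc n) (rrt_level1 n par) else rrt_level1 n par)"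
  by (auto simp: rrt_level1_eq)

lemma rrt_level1_subset: "rrt_level1 n par \<subseteq> {1..n}"
  by (auto simp: rrt_level1_eq)

lemma finite_rrt_level1 [simp]: "finite (rrt_level1 n par)"
  by (rule finite_subset[OF rrt_level1_subset]) simp

text \<open>One level-one vertex passes from degree \<open>j\<close> to \<open>Suc j\<close>. The
  truncated subtraction does no harm: the shift is applied to an occupied slot or weighted by
  \<open>x j\<close>.\<close>

definition slot_shift :: "nat \<Rightarrow> (nat \<Rightarrow> nat) \<Rightarrow> nat \<Rightarrow> nat" where
  "slot_shift j x = x(j := x j - 1, Suc j := Suc (x (Suc j)))"

lemma rrt_X_attach_root:
  assumes par: "par \<in> rrt_parents n"
  shows "rrt_X (Suc n) j (par(Suc n := 0)) = (if j = 1 then Suc (rrt_X n j par) else rrt_X n j par)"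
proof -
  let ?par = "par(Suc n := 0)"
  let ?A = "{i \<in> rrt_level1 n par. rrt_deg n par i = j}"
  have "{i \<in> rrt_level1 (Suc n) ?par. rrt_deg (Suc n) ?par i = j} =
      (if j = 1 then insert (Suc n) ?A else ?A)"
    using rrt_level1_subset[of n par]
    by (auto simp: rrt_level1_attach rrt_deg_attach[OF par] split: if_splits)
  moreover have "card (insert (Suc n) ?A) = Suc (card ?A)"
    by (rule card_insert_disjoint) (auto simp: rrt_level1_eq)
  ultimately show ?thesis
    unfolding rrt_X_def by (cases "j = 1") (simp_all only: simp_thms if_True if_False)
qed

lemma rrt_X_attach_level1:
  assumes par: "par \<in> rrt_parents n" and p: "p \<in> rrt_level1 n par"
  shows "rrt_X (Suc n) j (par(Suc n := p)) =
    slot_shift (rrt_deg n par p) (\<lambda>j. rrt_X n j par) j"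
proof -
  let ?par = "par(Suc n := p)"
  let ?A = "\<lambda>j. {i \<in> rrt_level1 n par. rrt_deg n par i = j}"
  have pn: "1 \<le> p" "p \<le> n" "par p = 0" using p by (auto simp: rrt_level1_eq)
  have fin: "finite (?A j)" for j by (auto simp: rrt_level1_eq)
  have "{i \<in> rrt_level1 (Suc n) ?par. rrt_deg (Suc n) ?par i = j} =
      (if j = rrt_deg n par p then ?A j - {p}
       else if j = Suc (rrt_deg n par p) then insert p (?A j) else ?A j)"
    using pn p by (auto simp: rrt_level1_attach rrt_deg_attach[OF par] split: if_splits)
  then show ?thesis using p fin by (auto simp: rrt_X_def slot_shift_def)
qed

lemma rrt_X_attach_deeper:
  assumes par: "par \<in> rrt_parents n" and p: "p \<in> {1..n} - rrt_level1 n par"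
  shows "rrt_X (Suc n) j (par(Suc n := p)) = rrt_X n j par"
proof -
  let ?par = "par(Suc n := p)"
  have "{i \<in> rrt_level1 (Suc n) ?par. rrt_deg (Suc n) ?par i = j} =
      {i \<in> rrt_level1 n par. rrt_deg n par i = j}"
    using p by (auto simp: rrt_level1_attach rrt_deg_attach[OF par] split: if_splits)
  then show ?thesis by (simp add: rrt_X_def)
qed

text \<open>The degree classes are disjoint subsets of \<open>{1..n}\<close>. This bound forces
  moments of order above n to vanish.\<close>

lemma sum_rrt_X_le: "(\<Sum>j\<in>{1..d}. rrt_X n j par) \<le> n"
proof -
  have "(\<Sum>j\<in>{1..d}. rrt_X n j par) =
      card (\<Union>j\<in>{1..d}. {i \<in> rrt_level1 n par. rrt_deg n par i = j})"
    unfolding rrt_X_def by (rule card_UN_disjoint[symmetric]) (auto simp: rrt_level1_eq)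
  also have "\<dots> \<le> card {1..n}"
    by (rule card_mono) (auto simp: rrt_level1_eq)
  finally show ?thesis by simp
qed

text \<open>This makes the first d counts a Markov chain of their own. Relative to
  \<open>g x\<close>, only the root and level-one parents contribute, and the \<open>x j\<close>
  level-one vertices of degree \<open>j\<close> contribute equally.\<close>

lemma sum_rrt_attach:
  fixes g :: "(nat \<Rightarrow> nat) \<Rightarrow> real"
  assumes par: "par \<in> rrt_parents n"
    and g: "\<And>x y. (\<And>j. j \<in> {1..d} \<Longrightarrow> x j = y j) \<Longrightarrow> g x = g y"
  defines "x \<equiv> \<lambda>j. rrt_X n j par"
  shows "(\<Sum>p\<le>n. g (\<lambda>j. rrt_X (Suc n) j (par(Suc n := p)))) =
    real (Suc n) * g x + (g (x(1 := Suc (x 1))) - g x) +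
    (\<Sum>j\<in>{1..d}. real (x j) * (g (slot_shift j x) - g x))"
proof -
  let ?L = "rrt_level1 n par" and ?D = "rrt_deg n par"
  let ?G = "\<lambda>p. g (\<lambda>j. rrt_X (Suc n) j (par(Suc n := p)))"
  have L: "?L \<subseteq> {1..n}" by (auto simp: rrt_level1_eq)
  then have finL: "finite ?L" by (rule finite_subset) simp
  have "(\<Sum>p\<le>n. ?G p - g x) = (\<Sum>p\<in>insert 0 ?L. ?G p - g x)"
  proof (rule sum.mono_neutral_right)
    show "\<forall>p\<in>{..n} - insert 0 ?L. ?G p - g x = 0"
    proof
      fix p assume "p \<in> {..n} - insert 0 ?L"
      then have "p \<in> {1..n} - ?L" by auto
      then show "?G p - g x = 0"
        by (simp add: rrt_X_attach_deeper[OF par] x_def)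
    qed
  qed (use L in auto)
  also have "\<dots> = (?G 0 - g x) + (\<Sum>p\<in>?L. ?G p - g x)"
    using finL L by (subst sum.insert) auto
  also have "?G 0 = g (x(1 := Suc (x 1)))"
    by (rule g) (simp add: rrt_X_attach_root[OF par] x_def)
  also have "(\<Sum>p\<in>?L. ?G p - g x) = (\<Sum>p\<in>?L. g (slot_shift (?D p) x) - g x)"
    by (rule sum.cong) (auto simp: rrt_X_attach_level1[OF par] x_def intro!: g)
  \<comment> \<open>A parent of degree above d changes only coordinates above d, which
    \<open>g\<close> does not see.\<close>
  also have "\<dots> = (\<Sum>p\<in>{p \<in> ?L. ?D p \<in> {1..d}}. g (slot_shift (?D p) x) - g x)"
  proof (rule sum.mono_neutral_right)
    show "\<forall>p\<in>?L - {p \<in> ?L. ?D p \<in> {1..d}}. g (slot_shift (?D p) x) - g x = 0"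
    proof
      fix p assume p: "p \<in> ?L - {p \<in> ?L. ?D p \<in> {1..d}}"
      then have "?D p \<ge> 1" using rrt_deg_eq[OF par] L by auto
      with p have "g (slot_shift (?D p) x) = g x"
        by (intro g) (auto simp: slot_shift_def)
      then show "g (slot_shift (?D p) x) - g x = 0" by simp
    qed
  qed (use finL in auto)
  also have "\<dots> = (\<Sum>j\<in>{1..d}. \<Sum>p\<in>{p \<in> {p \<in> ?L. ?D p \<in> {1..d}}. ?D p = j}. g (slot_shift (?D p) x) - g x)"
    using finL by (intro sum.group[symmetric]) auto
  also have "\<dots> = (\<Sum>j\<in>{1..d}. \<Sum>p\<in>{p \<in> ?L. ?D p = j}. g (slot_shift j x) - g x)"
    by (intro sum.cong) auto
  also have "\<dots> = (\<Sum>j\<in>{1..d}. real (x j) * (g (slot_shift j x) - g x))"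
    by (simp add: x_def rrt_X_def)
  finally show ?thesis
    by (simp add: sum_subtractf fun_upd_def)
qed

section \<open>Mixed factorial moments\<close>

definition mixed_ffall :: "nat \<Rightarrow> (nat \<Rightarrow> nat) \<Rightarrow> (nat \<Rightarrow> nat) \<Rightarrow> real" where
  "mixed_ffall d r x = (\<Prod>j\<in>{1..d}. ffall (x j) (r j))"

text \<open>At \<open>r j = 0\<close> the subtraction truncates; this is harmless because \<open>index_shift j r\<close> is
  always weighted by \<open>r j\<close>.\<close>
definition index_shift :: "nat \<Rightarrow> (nat \<Rightarrow> nat) \<Rightarrow> nat \<Rightarrow> nat" where
  "index_shift j r = (if j = 1 then r(1 := r 1 - 1) else r(j - 1 := Suc (r (j - 1)), j := r j - 1))"

lemma mixed_ffall_cong: "(\<And>j. j \<in> {1..d} \<Longrightarrow> x j = y j) \<Longrightarrow> mixed_ffall d r x = mixed_ffall d r y"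
  by (simp add: mixed_ffall_def)

lemma mixed_ffall_remove:
  assumes "j \<in> {1..d}"
  shows "mixed_ffall d r x = ffall (x j) (r j) * (\<Prod>i\<in>{1..d} - {j}. ffall (x i) (r i))"
  unfolding mixed_ffall_def by (rule prod.remove) (use assms in auto)

lemma mixed_ffall_remove2:
  assumes "j \<in> {1..<d}"
  shows "mixed_ffall d r x = ffall (x j) (r j) * ffall (x (Suc j)) (r (Suc j)) *
    (\<Prod>i\<in>{1..d} - {j, Suc j}. ffall (x i) (r i))"
proof -
  have "(\<Prod>i\<in>{1..d} - {j}. ffall (x i) (r i)) =
      ffall (x (Suc j)) (r (Suc j)) * (\<Prod>i\<in>{1..d} - {j} - {Suc j}. ffall (x i) (r i))"
    by (rule prod.remove) (use assms in auto)
  moreover have "{1..d} - {j} - {Suc j} = {1..d} - {j, Suc j}" by auto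
  ultimately show ?thesis using mixed_ffall_remove[of j d r x] assms by (simp add: mult_ac)
qed

lemma mixed_ffall_add_first:
  assumes "d \<ge> 1"
  shows "mixed_ffall d r (x(1 := Suc (x 1))) - mixed_ffall d r x =
    real (r 1) * mixed_ffall d (index_shift 1 r) x"
  using assms by (simp add: mixed_ffall_remove[of 1] index_shift_def ffall_Suc_left algebra_simps)

text \<open>The gain term carries \<open>x j - r j\<close> by absorption. In its main part
  subtracting \<open>x j\<close> leaves only \<open>- r j\<close>; in the part lowered at
  \<open>Suc j\<close> the factor raises the order at \<open>j\<close> by one. So no free factor
  \<open>x j\<close> survives.\<close>

lemma mixed_ffall_move:
  assumes j: "j \<in> {1..<d}"
  shows "real (x j) * (mixed_ffall d r (slot_shift j x) - mixed_ffall d r x) =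
    real (r (Suc j)) * mixed_ffall d (index_shift (Suc j) r) x - real (r j) * mixed_ffall d r x"
proof -
  define P where "P = (\<Prod>i\<in>{1..d} - {j, Suc j}. ffall (x i) (r i))"
  have P1: "(\<Prod>i\<in>{1..d} - {j, Suc j}. ffall (slot_shift j x i) (r i)) = P"
    unfolding P_def by (rule prod.cong) (auto simp: slot_shift_def)
  have P2: "(\<Prod>i\<in>{1..d} - {j, Suc j}. ffall (x i) (index_shift (Suc j) r i)) = P"
    unfolding P_def using j by (intro prod.cong) (auto simp: index_shift_def)
  define A where "A = ffall (x j) (r j)"
  define B where "B = ffall (x (Suc j)) (r (Suc j))"
  define B' where "B' = ffall (x (Suc j)) (r (Suc j) - 1)"
  have 0: "mixed_ffall d r x = A * B * P"
    unfolding mixed_ffall_remove2[OF j] by (simp add: A_def B_def P_def)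
  have "real (x j) * mixed_ffall d r (slot_shift j x) =
      (real (x j) * ffall (x j - 1) (r j)) * ffall (Suc (x (Suc j))) (r (Suc j)) * P"
    unfolding mixed_ffall_remove2[OF j] P1 by (simp add: slot_shift_def)
  then have 1: "real (x j) * mixed_ffall d r (slot_shift j x) =
      (real (x j) - real (r j)) * A * (B + real (r (Suc j)) * B') * P"
    unfolding mult_ffall_diff ffall_Suc_left by (simp add: A_def B_def B'_def)
  have "mixed_ffall d (index_shift (Suc j) r) x = ffall (x j) (Suc (r j)) * B' * P"
    unfolding mixed_ffall_remove2[OF j] P2 using j by (simp add: index_shift_def B'_def)
  then have 2: "mixed_ffall d (index_shift (Suc j) r) x = (real (x j) - real (r j)) * A * B' * P"
    by (simp add: ffall_Suc_right A_def)
  show ?thesis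
    unfolding right_diff_distrib 1 2 unfolding 0 by (simp add: algebra_simps)
qed

text \<open>A vertex leaving degree d arrives at coordinate \<open>Suc d\<close>, outside the
  product, so only the loss term remains.\<close>

lemma mixed_ffall_drop_last:
  assumes "d \<ge> 1"
  shows "real (x d) * (mixed_ffall d r (slot_shift d x) - mixed_ffall d r x) =
    - real (r d) * mixed_ffall d r x"
proof -
  define P where "P = (\<Prod>i\<in>{1..d} - {d}. ffall (x i) (r i))"
  have d: "d \<in> {1..d}" using assms by simp
  have P1: "(\<Prod>i\<in>{1..d} - {d}. ffall (slot_shift d x i) (r i)) = P"
    unfolding P_def by (rule prod.cong) (auto simp: slot_shift_def)
  have 1: "real (x d) * mixed_ffall d r (slot_shift d x) = (real (x d) * ffall (x d - 1) (r d)) * P"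
    unfolding mixed_ffall_remove[OF d] P1 by (simp add: slot_shift_def)
  have 0: "mixed_ffall d r x = ffall (x d) (r d) * P"
    unfolding mixed_ffall_remove[OF d] P_def ..
  show ?thesis
    unfolding right_diff_distrib 1 mult_ffall_diff unfolding 0 by (simp add: algebra_simps)
qed

lemma mixed_ffall_generator:
  assumes "d \<ge> 1"
  shows "(mixed_ffall d r (x(1 := Suc (x 1))) - mixed_ffall d r x) +
      (\<Sum>j\<in>{1..d}. real (x j) * (mixed_ffall d r (slot_shift j x) - mixed_ffall d r x)) =
    (\<Sum>j\<in>{1..d}. real (r j) * mixed_ffall d (index_shift j r) x) -
      real (\<Sum>j\<in>{1..d}. r j) * mixed_ffall d r x"
proof -
  let ?m = "mixed_ffall d r x"
  let ?h = "\<lambda>j. real (r j) * mixed_ffall d (index_shift j r) x"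
  \<comment> \<open>Losses are indexed by the degree left, gains by the degree reached. Splitting
    the former at d and the latter at 1 matches the two sums.\<close>
  have last: "(\<Sum>j\<in>{1..d}. f j) = f d + (\<Sum>j\<in>{1..<d}. f j)" for f :: "nat \<Rightarrow> real"
  proof -
    have "{1..d} = insert d {1..<d}" using assms by auto
    then show ?thesis by simp
  qed
  have first: "(\<Sum>j\<in>{1..d}. f j) = f 1 + (\<Sum>j\<in>{1..<d}. f (Suc j))" for f :: "nat \<Rightarrow> real"
  proof -
    have "{1..d} = insert 1 (Suc ` {1..<d})" using assms by (auto simp: image_Suc_atLeastLessThan)
    then have "(\<Sum>j\<in>{1..d}. f j) = (\<Sum>j\<in>insert 1 (Suc ` {1..<d}). f j)"
      by (rule arg_cong)
    also have "\<dots> = f 1 + (\<Sum>j\<in>Suc ` {1..<d}. f j)"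
      by (rule sum.insert) auto
    also have "(\<Sum>j\<in>Suc ` {1..<d}. f j) = (\<Sum>j\<in>{1..<d}. f (Suc j))"
      by (subst sum.reindex) auto
    finally show ?thesis .
  qed
  have "(\<Sum>j\<in>{1..d}. real (x j) * (mixed_ffall d r (slot_shift j x) - ?m)) =
      - real (r d) * ?m + (\<Sum>j\<in>{1..<d}. ?h (Suc j) - real (r j) * ?m)"
    unfolding last mixed_ffall_drop_last[OF assms]
    by (intro arg_cong2[of _ _ _ _ "(+)"] sum.cong mixed_ffall_move) auto
  also have "\<dots> = (\<Sum>j\<in>{1..<d}. ?h (Suc j)) - (\<Sum>j\<in>{1..d}. real (r j) * ?m)"
    unfolding last by (simp add: sum_subtractf)
  finally show ?thesis
    unfolding mixed_ffall_add_first[OF assms] first[of ?h] by (simp add: sum_distrib_right)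
qed

section \<open>Recurrence, uniform bound and limit of the moments\<close>

lemma set_rrt_pmf [simp]: "set_pmf (rrt_pmf n) = rrt_parents n"
  by (simp add: rrt_pmf_def)

lemma integrable_rrt_pmf [simp]: "integrable (rrt_pmf n) (f :: _ \<Rightarrow> real)"
  by (rule integrable_measure_pmf_finite) simp

definition rrt_moment :: "nat \<Rightarrow> nat \<Rightarrow> (nat \<Rightarrow> nat) \<Rightarrow> real" where
  "rrt_moment d n r = measure_pmf.expectation (rrt_pmf n) (\<lambda>par. mixed_ffall d r (\<lambda>j. rrt_X n j par))"

text \<open>Averaging over the new parent acts as the identity plus \<open>1 / (n + 1)\<close> times
  the generator; the generator identity closes the system of moments.\<close>

lemma rrt_moment_Suc:
  assumes "d \<ge> 1"
  shows "rrt_moment d (Suc n) r =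
    (1 - real (\<Sum>j\<in>{1..d}. r j) / real (Suc n)) * rrt_moment d n r +
    (\<Sum>j\<in>{1..d}. real (r j) * rrt_moment d n (index_shift j r)) / real (Suc n)"
proof -
  let ?X = "\<lambda>par j. rrt_X n j par"
  let ?s = "real (\<Sum>j\<in>{1..d}. r j)"
  have "rrt_moment d (Suc n) r = measure_pmf.expectation (rrt_pmf n)
      (\<lambda>par. (1 - ?s / real (Suc n)) * mixed_ffall d r (?X par) +
        (\<Sum>j\<in>{1..d}. real (r j) * mixed_ffall d (index_shift j r) (?X par)) / real (Suc n))"
    unfolding rrt_moment_def expectation_rrt_Suc
  proof (rule integral_cong_AE)
    \<comment> \<open>The attachment formula holds for valid parent functions, that is, on the
      support.\<close>
    show "AE par in rrt_pmf n. (\<Sum>p\<le>n. mixed_ffall d r (\<lambda>j. rrt_X (Suc n) j (par(Suc n := p)))) / real (Suc n) =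
      (1 - ?s / real (Suc n)) * mixed_ffall d r (?X par) +
        (\<Sum>j\<in>{1..d}. real (r j) * mixed_ffall d (index_shift j r) (?X par)) / real (Suc n)"
    proof (rule AE_pmfI)
      fix par assume "par \<in> set_pmf (rrt_pmf n)"
      then have par: "par \<in> rrt_parents n" by simp
      show "(\<Sum>p\<le>n. mixed_ffall d r (\<lambda>j. rrt_X (Suc n) j (par(Suc n := p)))) / real (Suc n) =
        (1 - ?s / real (Suc n)) * mixed_ffall d r (?X par) +
        (\<Sum>j\<in>{1..d}. real (r j) * mixed_ffall d (index_shift j r) (?X par)) / real (Suc n)"
      proof -
        let ?S = "\<Sum>j\<in>{1..d}. real (r j) * mixed_ffall d (index_shift j r) (?X par)"
        have "(\<Sum>p\<le>n. mixed_ffall d r (\<lambda>j. rrt_X (Suc n) j (par(Suc n := p)))) =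
            real (Suc n) * mixed_ffall d r (?X par) + (?S - ?s * mixed_ffall d r (?X par))"
          using sum_rrt_attach[OF par, where d = d and g = "mixed_ffall d r", OF mixed_ffall_cong]
            mixed_ffall_generator[OF assms, of r "?X par"]
          by (simp add: add.assoc)
        then show ?thesis
          by (simp only:) (simp add: add_divide_distrib diff_divide_distrib left_diff_distrib
            del: of_nat_Suc of_nat_sum)
      qed
    qed
  qed auto
  then show ?thesis
    by (simp add: rrt_moment_def)
qed

lemma rrt_moment_nonneg: "rrt_moment d n r \<ge> 0"
  unfolding rrt_moment_def mixed_ffall_def
  by (intro Bochner_Integration.integral_nonneg prod_nonneg) simp_all

text \<open>The counts sum to at most n, so some count lies below its order and its falling
  factorial vanishes.\<close>

lemma rrt_moment_eq_0:
  assumes "n < (\<Sum>j\<in>{1..d}. r j)"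
  shows "rrt_moment d n r = 0"
proof -
  have "mixed_ffall d r (\<lambda>j. rrt_X n j par) = 0" for par
  proof -
    have "\<not> (\<Sum>j\<in>{1..d}. r j) \<le> (\<Sum>j\<in>{1..d}. rrt_X n j par)"
      using sum_rrt_X_le[where d=d and n=n and par=par] assms by linarith
    then obtain j where "j \<in> {1..d}" "rrt_X n j par < r j"
      by (meson leI sum_mono)
    then show ?thesis by (auto simp: mixed_ffall_def intro!: prod_zero ffall_eq_0)
  qed
  then show ?thesis by (simp add: rrt_moment_def)
qed

lemma rrt_moment_empty:
  assumes "(\<Sum>j\<in>{1..d}. r j) = 0"
  shows "rrt_moment d n r = 1"
  using assms by (simp add: rrt_moment_def mixed_ffall_def)

text \<open>For total order at most \<open>Suc n\<close> the recurrence is a convex combination of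
  moments at time n. For larger order the first coefficient would be negative, but the moment is
  zero.\<close>

lemma rrt_moment_le_1:
  assumes "d \<ge> 1"
  shows "rrt_moment d n r \<le> 1"
proof (induction n arbitrary: r)
  case 0
  then show ?case
    using rrt_moment_empty[where n = 0] rrt_moment_eq_0[where n = 0] by (metis gr0I le_numeral_extra(4) zero_le_one)
next
  case (Suc n)
  let ?s = "\<Sum>j\<in>{1..d}. r j"
  show ?case
  proof (cases "?s \<le> Suc n")
    case True
    have c: "0 \<le> 1 - real ?s / real (Suc n)"
      using True by (simp add: divide_le_eq del: of_nat_Suc of_nat_sum)
    have "(\<Sum>j\<in>{1..d}. real (r j) * rrt_moment d n (index_shift j r)) \<le> (\<Sum>j\<in>{1..d}. real (r j) * 1)"
      by (intro sum_mono mult_left_mono Suc.IH) auto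
    then have "rrt_moment d (Suc n) r \<le> (1 - real ?s / real (Suc n)) * 1 + real ?s / real (Suc n)"
      unfolding rrt_moment_Suc[OF assms]
      by (intro add_mono mult_left_mono c Suc.IH divide_right_mono) auto
    then show ?thesis by simp
  next
    case False
    then show ?thesis by (simp add: rrt_moment_eq_0)
  qed
qed

text \<open>Moving a unit from \<open>j\<close> to \<open>j - 1\<close>, or deleting it at 1, lowers
  the weight by one. This is the measure for the induction on orders.\<close>

lemma weight_index_shift:
  assumes j: "j \<in> {1..d}" and r: "r j > 0"
  shows "(\<Sum>i\<in>{1..d}. i * index_shift j r i) < (\<Sum>i\<in>{1..d}. i * r i)"
proof (cases "j = 1")
  case True
  then show ?thesis
    using j r by (intro sum_strict_mono_ex1) (auto simp: index_shift_def)
next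
  case False
  define k where "k = j - 1"
  have jk: "j = Suc k" "k \<in> {1..d}" "k \<noteq> j" using False j by (auto simp: k_def)
  have split: "(\<Sum>i\<in>{1..d}. i * f i) = j * f j + (k * f k + (\<Sum>i\<in>{1..d} - {j} - {k}. i * f i))" for f :: "nat \<Rightarrow> nat"
    using j jk by (subst sum.remove[of _ j]; (subst sum.remove[of _ k])?) auto
  have "(\<Sum>i\<in>{1..d} - {j} - {k}. i * index_shift j r i) = (\<Sum>i\<in>{1..d} - {j} - {k}. i * r i)"
    using False by (intro sum.cong) (auto simp: index_shift_def k_def)
  moreover have "index_shift j r j = r j - 1" "index_shift j r k = Suc (r k)"
    using False jk by (auto simp: index_shift_def)
  moreover obtain q where "r j = Suc q" using r by (cases "r j") auto
  ultimately show ?thesis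
    unfolding split using jk by simp
qed

lemma rrt_moment_tendsto:
  assumes "d \<ge> 1"
  shows "(\<lambda>n. rrt_moment d n r) \<longlonglongrightarrow> 1"
proof (induction "\<Sum>j\<in>{1..d}. j * r j" arbitrary: r rule: less_induct)
  case less
  let ?s = "\<Sum>j\<in>{1..d}. r j"
  show ?case
  proof (cases "?s = 0")
    case True
    then show ?thesis by (simp add: rrt_moment_empty)
  next
    case False
    let ?u = "\<lambda>n. rrt_moment d n r - 1"
    let ?v = "\<lambda>n. \<Sum>j\<in>{1..d}. real (r j) * (rrt_moment d n (index_shift j r) - 1)"
    have "?u \<longlonglongrightarrow> 0"
    \<comment> \<open>Subtracting the limit 1 preserves the recurrence, since its coefficients sum
      to 1; here \<open>c\<close> is the total order.\<close>
    proof (rule tendsto_0_averaging_recurrence)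
      have "(\<lambda>n. real (r j) * (rrt_moment d n (index_shift j r) - 1)) \<longlonglongrightarrow> 0" if j: "j \<in> {1..d}" for j
      \<comment> \<open>The weight decreases only if \<open>r j > 0\<close>; otherwise the summand
        is zero.\<close>
      proof (cases "r j = 0")
        case False
        then have "(\<lambda>n. rrt_moment d n (index_shift j r)) \<longlonglongrightarrow> 1"
          by (intro less weight_index_shift j) simp
        then show ?thesis by (intro tendsto_mult_right_zero) (simp add: LIM_zero)
      qed simp
      then show "?v \<longlonglongrightarrow> 0" by (intro tendsto_null_sum) auto
      show "real ?s \<ge> 1" using False by linarith
      show "?u (Suc n) = (1 - real ?s / real (Suc n)) * ?u n + ?v n / real (Suc n)" for n
        unfolding rrt_moment_Suc[OF assms]
        by (simp add: sum_subtractf right_diff_distrib left_diff_distrib diff_divide_distrib del: of_nat_Suc)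
    qed
    then show ?thesis by (simp add: LIM_zero_iff)
  qed
qed

section \<open>Point probabilities\<close>

text \<open>The factor \<open>exp 1\<close> cancels the normalisation of the Poisson weights \<open>exp (-1) / fact r\<close>, so that the
  inversion series becomes an expectation under the limit law itself.\<close>
definition inversion_kernel :: "nat \<Rightarrow> (nat \<Rightarrow> nat) \<Rightarrow> (nat \<Rightarrow> nat) \<Rightarrow> real" where
  "inversion_kernel d k r = (\<Prod>j\<in>{1..d}. exp 1 * (-1) ^ (r j + k j) * real (r j choose k j))"

text \<open>For each fixed tree the kernel expectation is the indicator that its counts equal
  \<open>k\<close>. Averaging over the finitely many trees then needs only linearity of the
  integral.\<close>

lemma pmf_rrt_X_eq:
  assumes k: "\<And>j. j \<notin> {1..d} \<Longrightarrow> k j = 0"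
  shows "pmf (map_pmf (\<lambda>par j. if j \<in> {1..d} then rrt_X n j par else 0) (rrt_pmf n)) k =
    measure_pmf.expectation (Pi_pmf {1..d} 0 (\<lambda>_. poisson_pmf 1))
      (\<lambda>r. inversion_kernel d k r * rrt_moment d n r)"
proof -
  let ?Q = "Pi_pmf {1..d} 0 (\<lambda>_. poisson_pmf 1)"
  let ?G = "\<lambda>par j. if j \<in> {1..d} then rrt_X n j par else 0"
  let ?X = "\<lambda>par j. rrt_X n j par"
  let ?F = "\<lambda>x j r. exp 1 * (-1) ^ (r + k j) * real (r choose k j) * ffall (x j) r"
  have F: "inversion_kernel d k r * mixed_ffall d r x = (\<Prod>j\<in>{1..d}. ?F x j (r j))" for r x
    by (simp add: inversion_kernel_def mixed_ffall_def prod.distrib)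
  \<comment> \<open>\<open>ffall (x j) r\<close> vanishes for \<open>r > x j\<close>, so the support
    is finite.\<close>
  have intF: "integrable (poisson_pmf 1) (?F x j)" for x j
    by (rule integrable_finite_support_pmf[of "{..x j}"]) (auto simp: ffall_eq_0)
  have int: "integrable ?Q (\<lambda>r. inversion_kernel d k r * mixed_ffall d r x)" for x
    unfolding F by (rule integrable_prod_Pi_pmf) (use intF in auto)
  have ind: "measure_pmf.expectation ?Q (\<lambda>r. inversion_kernel d k r * mixed_ffall d r (?X par)) =
      indicator (?G -` {k}) par" for par
  proof -
    have "measure_pmf.expectation ?Q (\<lambda>r. inversion_kernel d k r * mixed_ffall d r (?X par)) =
        (\<Prod>j\<in>{1..d}. of_bool (rrt_X n j par = k j))"
      unfolding F by (subst expectation_prod_Pi_pmf_real)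
        (use intF in \<open>auto simp: expectation_poisson_indicator_kernel\<close>)
    also have "\<dots> = of_bool (\<forall>j\<in>{1..d}. rrt_X n j par = k j)"
      by (auto simp: of_bool_def)
    also have "(\<forall>j\<in>{1..d}. rrt_X n j par = k j) \<longleftrightarrow> ?G par = k"
      using k by (auto simp: fun_eq_iff)
    finally show ?thesis by (auto simp: indicator_def)
  qed
  have avg: "measure_pmf.expectation (rrt_pmf n) f = (\<Sum>par\<in>rrt_parents n. f par / card (rrt_parents n))"
    for f :: "_ \<Rightarrow> real"
    by (simp add: rrt_pmf_def integral_pmf_of_set sum_divide_distrib)
  have "pmf (map_pmf ?G (rrt_pmf n)) k = measure_pmf.expectation (rrt_pmf n) (indicator (?G -` {k}))"
    by (simp add: pmf_map)
  also have "\<dots> = (\<Sum>par\<in>rrt_parents n. measure_pmf.expectation ?Q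
      (\<lambda>r. inversion_kernel d k r * mixed_ffall d r (?X par)) / card (rrt_parents n))"
    unfolding avg ind ..
  also have "\<dots> = measure_pmf.expectation ?Q (\<lambda>r. \<Sum>par\<in>rrt_parents n.
      inversion_kernel d k r * mixed_ffall d r (?X par) / card (rrt_parents n))"
    unfolding integral_divide_zero[symmetric]
    by (rule Bochner_Integration.integral_sum[symmetric]) (intro integrable_divide int)
  also have "\<dots> = measure_pmf.expectation ?Q (\<lambda>r. inversion_kernel d k r * rrt_moment d n r)"
    unfolding rrt_moment_def avg by (simp add: sum_distrib_left)
  finally show ?thesis .
qed

theorem theorem3p1:
  fixes d :: nat
  assumes "d \<ge> 1"
  shows "converges_in_distribution
           (\<lambda>n. map_pmf (\<lambda>par. \<lambda>j. if j \<in> {1..d} then rrt_X n j par else 0) (rrt_pmf n))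
           (Pi_pmf {1..d} 0 (\<lambda>_. poisson_pmf 1))"
proof (rule converges_in_distribution_pmfI)
  fix k :: "nat \<Rightarrow> nat"
  let ?P = "\<lambda>n. map_pmf (\<lambda>par. \<lambda>j. if j \<in> {1..d} then rrt_X n j par else 0) (rrt_pmf n)"
  let ?Q = "Pi_pmf {1..d} 0 (\<lambda>_. poisson_pmf 1)"
  show "(\<lambda>n. pmf (?P n) k) \<longlonglongrightarrow> pmf ?Q k"
  \<comment> \<open>A point with a nonzero coordinate outside \<open>{1..d}\<close> has mass zero
    under all laws involved.\<close>
  proof (cases "\<forall>j. j \<notin> {1..d} \<longrightarrow> k j = 0")
    case True
    have "(\<lambda>n. measure_pmf.expectation ?Q (\<lambda>r. inversion_kernel d k r * rrt_moment d n r))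
        \<longlonglongrightarrow> measure_pmf.expectation ?Q (inversion_kernel d k)"
    \<comment> \<open>Moments lie between 0 and 1, so the absolute kernel dominates uniformly in n;
      it is integrable as a product of Poisson-integrable factors.\<close>
    proof (rule integral_dominated_convergence[where w = "\<lambda>r. \<bar>inversion_kernel d k r\<bar>"])
      show "integrable ?Q (\<lambda>r. \<bar>inversion_kernel d k r\<bar>)"
        unfolding inversion_kernel_def
        by (intro integrable_abs integrable_prod_Pi_pmf integrable_poisson_binomial) auto
      show "AE r in ?Q. (\<lambda>n. inversion_kernel d k r * rrt_moment d n r) \<longlonglongrightarrow> inversion_kernel d k r"
        using tendsto_mult_left[OF rrt_moment_tendsto[OF assms]] by fastforce
      show "AE r in ?Q. norm (inversion_kernel d k r * rrt_moment d n r) \<le> \<bar>inversion_kernel d k r\<bar>" for n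
        using rrt_moment_le_1[OF assms] rrt_moment_nonneg
        by (simp add: abs_mult mult_left_le)
    qed auto
    moreover have "measure_pmf.expectation ?Q (inversion_kernel d k) = pmf ?Q k"
    proof -
      have "pmf ?Q k = (\<Prod>j\<in>{1..d}. pmf (poisson_pmf 1) (k j))"
        using True by (intro pmf_Pi') auto
      then show ?thesis
        unfolding inversion_kernel_def
        by (subst expectation_prod_Pi_pmf_real)
           (simp_all only: integrable_poisson_binomial expectation_poisson_alternating_binomial finite_atLeastAtMost)
    qed
    moreover have "pmf (?P n) k =
        measure_pmf.expectation ?Q (\<lambda>r. inversion_kernel d k r * rrt_moment d n r)" for n
      using True by (intro pmf_rrt_X_eq) auto
    ultimately show ?thesis by (simp only:)
  next
    case False
    then have "pmf (?P n) k = 0" for n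
      by (auto simp: pmf_eq_0_set_pmf)
    moreover have "pmf ?Q k = 0"
      using False by (intro pmf_Pi_outside) auto
    ultimately show ?thesis by simp
  qed
qed

end
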